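(* Let $\mathfrak{B}$ be an arbitrary Banach space, let $a\in\mathbb{R}$, $f\in L_1^{loc}([a,\infty),\mathfrak{B})$, $t_0\in(a,\infty)$ and $\alpha\in(0,1)$. The conformable derivative $T_a^{\alpha}f(t_0)$ with lower terminal $a$ exists if and only if $f$ has a first derivative $f'(t_0)$ at the point $t_0$, and in this case $$T_a^{\alpha}f(t_0)=(t_0-a)^{1-\alpha}f'(t_0).$$
   Context: $L_1^{loc}([a,\infty),\mathfrak{B})$ denotes the linear space of all functions $f:[a,\infty)\to\mathfrak{B}$ that are Bochner strongly measurable and Bochner integrable (i.e. $\|f(t)\|_{\mathfrak{B}}$ is Lebesgue integrable) on every compact subinterval of $[a,\infty)$. For $\alpha\in(0,1]$ and $t\in(a,\infty)$, the (left-sided) conformable derivative of order $\alpha$ of $f$ at $t$ with lower terminal $a$ is $$T_a^{\alpha}f(t)=\lim_{\theta\to 0}\frac{f(t+\theta(t-a)^{1-\alpha})-f(t)}{\theta},$$ if this limit exists in the norm of $\mathfrak{B}$. The first derivative of $f$ at $t_0$ is the vector $f'(t_0)\in\mathfrak{B}$ with $\lim_{h\to 0}\left\|\frac{f(t_0+h)-f(t_0)}{h}-f'(t_0)\right\|_{\mathfrak{B}}=0$, if such a vector exists. *)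

theory Defs
  imports "HOL-Analysis.Analysis"
begin

(* The library's Bochner integrability (integrable, set_integrable) is restricted to
   second countable codomains, hence to separable Banach spaces.  The notions below make
   sense in an arbitrary Banach space. *)

definition bochner_strongly_measurable :: "'a measure \<Rightarrow> ('a \<Rightarrow> 'b::real_normed_vector) \<Rightarrow> bool"
  where "bochner_strongly_measurable M f \<longleftrightarrow>
    (\<exists>s. (\<forall>n. simple_function M (s n)) \<and> (AE x in M. (\<lambda>n. s n x) \<longlonglongrightarrow> f x))"

definition bochner_integrable :: "'a measure \<Rightarrow> ('a \<Rightarrow> 'b::banach) \<Rightarrow> bool"
  where "bochner_integrable M f \<longleftrightarrow>
    bochner_strongly_measurable M f \<and> integrable M (\<lambda>x. norm (f x))"

(* Functions on {a..} are represented by total functions; values below a are irrelevant. *)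

definition L1_loc :: "real \<Rightarrow> (real \<Rightarrow> 'b::banach) set"
  where "L1_loc a = {f. \<forall>c d. a \<le> c \<and> c \<le> d \<longrightarrow> bochner_integrable (lebesgue_on {c..d}) f}"

(* Only used for t > a, where the base of powr is positive and f is evaluated
   inside {a<..} for all small \<theta>. *)

definition has_conformable_derivative ::
    "real \<Rightarrow> real \<Rightarrow> (real \<Rightarrow> 'b::real_normed_vector) \<Rightarrow> 'b \<Rightarrow> real \<Rightarrow> bool"
  where "has_conformable_derivative a \<alpha> f D t \<longleftrightarrow>
    ((\<lambda>\<theta>. (f (t + \<theta> * (t - a) powr (1 - \<alpha>)) - f t) /\<^sub>R \<theta>) \<longlongrightarrow> D) (at 0)"

definition conformable_derivative ::
    "real \<Rightarrow> real \<Rightarrow> (real \<Rightarrow> 'b::real_normed_vector) \<Rightarrow> real \<Rightarrow> 'b"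
  where "conformable_derivative a \<alpha> f t = (THE D. has_conformable_derivative a \<alpha> f D t)"

end

theory Submission
  imports Defs
begin

text \<open>Put c = (t - a) powr (1 - \<alpha>), which is positive for t > a. The substitution h =
  \<theta> * c turns the conformable quotient into c times the ordinary difference quotient of f at
  t, so both limits exist together and differ by the factor c. Formally, the conformable derivative
  is the ordinary derivative at 0 of \<theta> \<mapsto> f (t + \<theta> * c), and
  \<open>has_vector_derivative_scale_iff\<close> carries out the substitution by the chain
  rule.\<close>

text \<open>Links the library derivative, defined through a linear approximation, to the quotient
  used for the conformable derivative: for h \<noteq> 0 the error of the quotient has the same norm
  as the remainder divided by h.\<close>

lemma has_vector_derivative_iff_difference_quotient:
  fixes f :: "real \<Rightarrow> 'b::real_normed_vector"
  shows "(f has_vector_derivative D) (at t) \<longleftrightarrow>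
    ((\<lambda>h. (f (t + h) - f t) /\<^sub>R h) \<longlongrightarrow> D) (at 0)"
proof -
  have eq: "norm ((f (t + h) - f t) /\<^sub>R h - D) = norm (f (t + h) - f t - h *\<^sub>R D) / norm h"
    if "h \<noteq> 0" for h
  proof -
    have "(f (t + h) - f t) /\<^sub>R h - D = (f (t + h) - f t - h *\<^sub>R D) /\<^sub>R h"
      using that by (simp add: scaleR_diff_right)
    then show ?thesis
      by (simp add: divide_inverse_commute)
  qed
  have "(f has_vector_derivative D) (at t) \<longleftrightarrow>
      ((\<lambda>h. norm (f (t + h) - f t - h *\<^sub>R D) / norm h) \<longlongrightarrow> 0) (at 0)"
    by (simp add: has_vector_derivative_def has_derivative_at bounded_linear_scaleR_left)
  also have "\<dots> \<longleftrightarrow> ((\<lambda>h. norm ((f (t + h) - f t) /\<^sub>R h - D)) \<longlongrightarrow> 0) (at 0)"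
    by (intro Lim_cong_within) (simp_all add: eq)
  also have "\<dots> \<longleftrightarrow> ((\<lambda>h. (f (t + h) - f t) /\<^sub>R h) \<longlongrightarrow> D) (at 0)"
    by (simp add: tendsto_norm_zero_iff flip: LIM_zero_iff[where l = D])
  finally show ?thesis .
qed

text \<open>The chain rule along the affine map \<theta> \<mapsto> t + \<theta> * c gives one
  direction. The other is the chain rule along its inverse, which exists because c \<noteq> 0; the
  factors 1 / c and c then cancel.\<close>

lemma has_vector_derivative_scale_iff:
  fixes f :: "real \<Rightarrow> 'b::real_normed_vector"
  assumes "c \<noteq> 0"
  shows "((\<lambda>\<theta>. f (t + \<theta> * c)) has_vector_derivative c *\<^sub>R D) (at 0) \<longleftrightarrow>
    (f has_vector_derivative D) (at t)"
proof
  assume "(f has_vector_derivative D) (at t)"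
  moreover have "((\<lambda>\<theta>. t + \<theta> * c) has_vector_derivative c) (at 0)"
    by (auto intro!: derivative_eq_intros)
  ultimately show "((\<lambda>\<theta>. f (t + \<theta> * c)) has_vector_derivative c *\<^sub>R D) (at 0)"
    using vector_diff_chain_at[of "\<lambda>\<theta>. t + \<theta> * c" c 0 f D] by (simp add: o_def)
next
  assume "((\<lambda>\<theta>. f (t + \<theta> * c)) has_vector_derivative c *\<^sub>R D) (at 0)"
  moreover have "((\<lambda>x. (x - t) / c) has_vector_derivative 1 / c) (at t)"
    using assms by (auto intro!: derivative_eq_intros)
  ultimately show "(f has_vector_derivative D) (at t)"
    using vector_diff_chain_at[of "\<lambda>x. (x - t) / c" "1 / c" t "\<lambda>\<theta>. f (t + \<theta> * c)" "c *\<^sub>R D"] assms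
    by (simp add: o_def)
qed

text \<open>The defining quotient is the ordinary difference quotient at 0 of the rescaled function,
  and a < t makes the scaling factor nonzero.\<close>

lemma has_conformable_derivative_iff:
  fixes f :: "real \<Rightarrow> 'b::real_normed_vector"
  assumes "a < t"
  shows "has_conformable_derivative a \<alpha> f ((t - a) powr (1 - \<alpha>) *\<^sub>R D) t \<longleftrightarrow>
    (f has_vector_derivative D) (at t)"
  using assms
    has_vector_derivative_iff_difference_quotient[of
      "\<lambda>\<theta>. f (t + \<theta> * (t - a) powr (1 - \<alpha>))" "(t - a) powr (1 - \<alpha>) *\<^sub>R D" 0]
  by (simp add: has_conformable_derivative_def has_vector_derivative_scale_iff)

text \<open>Limits at 0 are unique, so the definite description picks out D.\<close>

lemma conformable_derivative_eqI:
  "has_conformable_derivative a \<alpha> f D t \<Longrightarrow> conformable_derivative a \<alpha> f t = D"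
  unfolding conformable_derivative_def has_conformable_derivative_def
  by (rule the_equality) (auto intro: tendsto_unique[rotated])

theorem corollary3p4:
  fixes f :: "real \<Rightarrow> 'b::banach" and a t\<^sub>0 \<alpha> :: real
  assumes "f \<in> L1_loc a"
    and "a < t\<^sub>0"
    and "0 < \<alpha>" and "\<alpha> < 1"
  shows "((\<exists>D. has_conformable_derivative a \<alpha> f D t\<^sub>0) \<longleftrightarrow>
          (\<exists>D. (f has_vector_derivative D) (at t\<^sub>0))) \<and>
         ((\<exists>D. has_conformable_derivative a \<alpha> f D t\<^sub>0) \<longrightarrow>
          conformable_derivative a \<alpha> f t\<^sub>0 =
            (t\<^sub>0 - a) powr (1 - \<alpha>) *\<^sub>R vector_derivative f (at t\<^sub>0))"
proof -
  let ?c = "(t\<^sub>0 - a) powr (1 - \<alpha>)"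
  note iff = has_conformable_derivative_iff[OF \<open>a < t\<^sub>0\<close>, of \<alpha> f]
  \<comment> \<open>Since \<open>?c\<close> is nonzero, any D equals \<open>?c\<close> times D /
    \<open>?c\<close>, so \<open>iff\<close> applies to every conformable derivative, whatever form
    it is given in.\<close>
  have vector: "(f has_vector_derivative D /\<^sub>R ?c) (at t\<^sub>0)"
    if "has_conformable_derivative a \<alpha> f D t\<^sub>0" for D
    using that iff[of "D /\<^sub>R ?c"] \<open>a < t\<^sub>0\<close> by simp
  have "conformable_derivative a \<alpha> f t\<^sub>0 = ?c *\<^sub>R vector_derivative f (at t\<^sub>0)"
    if "has_conformable_derivative a \<alpha> f D t\<^sub>0" for D
    using conformable_derivative_eqI[OF that] vector_derivative_at[OF vector[OF that]] \<open>a < t\<^sub>0\<close>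
    by simp
  then show ?thesis
    using iff vector by blast
qed

end
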